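(* Let $D=(V,E)$ be a digraph and $e\in E$ an arc of $D$. Then \[ \sigma(D)= \begin{cases} \sigma(D_{-e})+x & \text{if } e \text{ is a loop},\\ \sigma(D_{-e})+x\,\sigma(D_{/e})-x\,\sigma(D_{\dagger e}) & \text{if } e=(u,v) \text{ is not a loop and there are no loops on } u \text{ or } v. \end{cases} \]
   Context: Digraphs are finite directed multigraphs; loops and multiple arcs are allowed. A directed cycle of length $k\ge 1$ consists of $k$ distinct vertices $v_1,\dots,v_k$ together with arcs $(v_1,v_2),\dots,(v_{k-1},v_k),(v_k,v_1)$. A loop is a cycle of length 1 and two opposite arcs form a cycle of length 2. Cycles are counted as sets of arcs, so parallel arcs give different cycles. The cycle polynomial is $\sigma(D)=\sigma(D;x)=\sum_{k=1}^{|V|}c_k(D)x^k$, where $c_k(D)$ is the number of directed cycles of length $k$ in $D$. The arc operations are as follows. $D_{-e}$ is obtained by deleting the arc $e$. If $e=(u,v)$ with $u\ne v$, then $D_{/e}$ is obtained from $D$ by removing all arcs with tail $u$ and all arcs with head $v$ (this includes $e$), and then identifying $u$ and $v$ into one new vertex. If $e=(u,u)$ is a loop, then $D_{/e}$ is obtained by deleting $u$ together with its incident arcs. For $e=(u,v)$, $D_{\dagger e}$ is obtained by deleting $u$ and $v$ and all arcs incident to them. *)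

theory Defs
  imports
    "Graph_Theory.Arc_Walk"
    "HOL-Computational_Algebra.Polynomial"
begin

text \<open>
  Finite directed multigraphs with loops are the locale \<open>fin_digraph\<close>. A directed cycle is a
  \<open>pre_digraph.cycle\<close>: a nonempty closed arc walk without repeated vertices, so that loops and
  pairs of opposite arcs are cycles. Such a walk has a distinguished starting arc; taking arc
  sets identifies exactly the rotations of one cycle and keeps parallel arcs apart.
\<close>

definition cycles_of_length :: "('a, 'b) pre_digraph \<Rightarrow> nat \<Rightarrow> 'b set set" where
  "cycles_of_length D k = set ` {p. pre_digraph.cycle D p \<and> length p = k}"

definition cycle_poly :: "('a, 'b) pre_digraph \<Rightarrow> int poly" where
  "cycle_poly D = (\<Sum>k = 1..card (verts D). monom (int (card (cycles_of_length D k))) k)"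

text \<open>
  For a non-loop \<open>e = (u, v)\<close> the new vertex obtained by identifying \<open>u\<close> and \<open>v\<close> reuses the
  name \<open>u\<close>; arcs keep their names, so arcs that become parallel are not merged, and a remaining
  arc \<open>(v, u)\<close> becomes a loop.
\<close>

definition contract_arc :: "('a, 'b) pre_digraph \<Rightarrow> 'b \<Rightarrow> ('a, 'b) pre_digraph" where
  "contract_arc D e =
     (let u = tail D e; v = head D e; merge = (\<lambda>w. if w = v then u else w) in
      if u = v then pre_digraph.del_vert D u
      else \<lparr> verts = merge ` verts D,
             arcs = {a \<in> arcs D. tail D a \<noteq> u \<and> head D a \<noteq> v},
             tail = merge \<circ> tail D,
             head = merge \<circ> head D \<rparr>)"

definition del_arc_ends :: "('a, 'b) pre_digraph \<Rightarrow> 'b \<Rightarrow> ('a, 'b) pre_digraph" where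
  "del_arc_ends D e = pre_digraph.del_vert (pre_digraph.del_vert D (tail D e)) (head D e)"

lemma fin_digraph_contract_arc:
  assumes "fin_digraph D" and "e \<in> arcs D"
  shows "fin_digraph (contract_arc D e)"
proof -
  interpret fin_digraph D by fact
  show ?thesis
    using assms(2) by unfold_locales
      (auto simp: contract_arc_def Let_def pre_digraph.del_vert_def split: if_splits)
qed

lemma fin_digraph_del_arc_ends:
  assumes "fin_digraph D"
  shows "fin_digraph (del_arc_ends D e)"
proof -
  interpret fin_digraph D by fact
  show ?thesis
    by unfold_locales (auto simp: del_arc_ends_def pre_digraph.del_vert_def)
qed

end

theory Submission
  imports Defs
begin

text \<open>
  Rotating a cycle through \<open>e = (u, v)\<close> so that it starts with \<open>e\<close> exhibits it as \<open>e\<close> followed by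
  a simple path from \<open>v\<close> to \<open>u\<close>. The same simple paths are exactly the cycles of \<open>D\<^sub>/\<^sub>e\<close> through the
  merged vertex, and the cycles of \<open>D\<^sub>/\<^sub>e\<close> avoiding that vertex are the cycles of the digraph without
  \<open>u\<close> and \<open>v\<close>.
\<close>

text \<open>Cycles of all lengths form one family. No separate record of the length is needed, since
  a cycle repeats no arc and its length is the cardinality of its arc set.\<close>

definition cycle_sets :: "('a, 'b) pre_digraph \<Rightarrow> 'b set set" where
  "cycle_sets D = set ` Collect (pre_digraph.cycle D)"

section \<open>Cycles through a given arc\<close>

context wf_digraph
begin

text \<open>\<open>cycle\<close> ignores the first entry of the vertex list of the closed walk. What
  remains is exactly the vertex list of \<open>q\<close> started at the head of \<open>a\<close>, so
  its distinctness makes \<open>q\<close> a simple path. A loop is the case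
  \<open>q = []\<close>.\<close>

lemma cycle_Cons_iff:
  "cycle (a # q) \<longleftrightarrow> a \<in> arcs G \<and> apath (head G a) q (tail G a)"
  by (auto simp: cycle_def awalk_Cons_iff apath_def)

lemma cycle_imp_distinct: "cycle p \<Longrightarrow> distinct p"
  by (auto simp: cycle_conv)

lemma cycle_imp_subset_arcs: "cycle p \<Longrightarrow> set p \<subseteq> arcs G"
  by (auto simp: cycle_def)

text \<open>The vertices that \<open>cycle\<close> requires to be distinct are the heads of the
  arcs. Rotation only permutes the list of heads, so it preserves this condition.\<close>

lemma cycle_rotate:
  assumes "cycle p" and "a \<in> set p"
  obtains q where "cycle (a # q)" and "set p = insert a (set q)"
proof -
  obtain xs ys where p: "p = xs @ a # ys"
    using assms(2) by (meson split_list)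
  obtain u where u: "awalk u p u" "distinct (tl (awalk_verts u p))"
    using assms(1) by (auto simp: cycle_def)
  have heads: "tl (awalk_verts w r) = map (head G) r" if "awalk w r w'" for w r w'
    using that by (subst awalk_verts_conv'[of w r w']) auto
  have "awalk u xs (tail G a)" "a \<in> arcs G" "awalk (head G a) ys u"
    using u(1) unfolding p by (auto simp: awalk_Cons_iff)
  then have walk: "awalk (tail G a) (a # ys @ xs) (tail G a)"
    by (auto simp: awalk_Cons_iff)
  have "distinct (map (head G) p)"
    using u by (simp add: heads)
  then have "distinct (map (head G) (a # ys @ xs))"
    by (auto simp: p)
  then have "cycle (a # ys @ xs)"
    using walk heads[OF walk] unfolding cycle_def by (metis list.discI)
  then show thesis
    by (rule that) (auto simp: p)
qed

lemma cycle_sets_through_iff: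
  assumes "a \<in> arcs G"
  shows "S \<in> cycle_sets G \<and> a \<in> S \<longleftrightarrow>
    (\<exists>q. S = insert a (set q) \<and> apath (head G a) q (tail G a))"
proof
  assume "S \<in> cycle_sets G \<and> a \<in> S"
  then obtain p where "cycle p" "S = set p" "a \<in> set p"
    by (auto simp: cycle_sets_def)
  then show "\<exists>q. S = insert a (set q) \<and> apath (head G a) q (tail G a)"
    by (metis cycle_rotate cycle_Cons_iff)
next
  assume "\<exists>q. S = insert a (set q) \<and> apath (head G a) q (tail G a)"
  then obtain q where "S = set (a # q)" "cycle (a # q)"
    using assms by (auto simp: cycle_Cons_iff)
  then show "S \<in> cycle_sets G \<and> a \<in> S"
    unfolding cycle_sets_def by (metis imageI insertI1 list.simps(15) mem_Collect_eq)
qed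

end

section \<open>Cycles in subdigraphs\<close>

lemma pre_digraph_cas_cong:
  assumes "\<And>a. a \<in> set p \<Longrightarrow> tail G a = tail H a \<and> head G a = head H a"
  shows "pre_digraph.cas G u p v \<longleftrightarrow> pre_digraph.cas H u p v"
  using assms by (induction p arbitrary: u) (auto simp: pre_digraph.cas.simps)

lemma pre_digraph_awalk_verts_cong:
  assumes "\<And>a. a \<in> set p \<Longrightarrow> tail G a = tail H a \<and> head G a = head H a"
  shows "pre_digraph.awalk_verts G u p = pre_digraph.awalk_verts H u p"
  using assms by (induction p arbitrary: u) (auto simp: pre_digraph.awalk_verts.simps)

text \<open>Chaining of arcs and the visited vertices depend only on the ends of the arcs of the
  walk, and the two digraphs agree on these.\<close>

lemma cycle_sets_subdigraph:
  assumes "wf_digraph G" and "wf_digraph H" and "arcs H \<subseteq> arcs G"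
    and ends: "\<And>a. a \<in> arcs H \<Longrightarrow> tail H a = tail G a \<and> head H a = head G a"
  shows "cycle_sets H = {S \<in> cycle_sets G. S \<subseteq> arcs H}"
proof -
  interpret G: wf_digraph G by fact
  interpret H: wf_digraph H by fact
  have "H.cycle p \<longleftrightarrow> G.cycle p \<and> set p \<subseteq> arcs H" for p
  proof (cases "p \<noteq> [] \<and> set p \<subseteq> arcs H")
    case True
    then have e: "\<And>a. a \<in> set p \<Longrightarrow> tail H a = tail G a \<and> head H a = head G a"
      using ends by blast
    \<comment> \<open>An \<open>awalk\<close> must also start at a vertex of its digraph. A nonempty
      closed walk starts at the tail of its first arc, which is a vertex of both \<open>G\<close>
      and \<open>H\<close>.\<close>
    have "hd p \<in> arcs H"
      using True by (metis hd_in_set subsetD)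
    then have "tail G (hd p) \<in> verts H" "tail G (hd p) \<in> verts G"
      using assms(3) ends H.wellformed(1)[of "hd p"] G.wellformed(1)[of "hd p"] by auto
    moreover have "G.cas u p u \<Longrightarrow> u = tail G (hd p)" for u
      using True by (cases p) auto
    ultimately show ?thesis
      using True assms(3)
      unfolding H.cycle_def G.cycle_def H.awalk_def G.awalk_def
        pre_digraph_cas_cong[OF e, of p, simplified] pre_digraph_awalk_verts_cong[OF e, of p, simplified]
      by (metis subset_trans)
  next
    case False
    then show ?thesis
      using H.cycle_imp_subset_arcs by (auto simp: H.cycle_def G.cycle_def)
  qed
  then show ?thesis
    by (auto simp: cycle_sets_def)
qed

lemma cycle_sets_del_arc:
  assumes "wf_digraph D"
  shows "cycle_sets (pre_digraph.del_arc D e) = {S \<in> cycle_sets D. e \<notin> S}"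
proof -
  interpret wf_digraph D by fact
  have "S \<subseteq> arcs D" if "S \<in> cycle_sets D" for S
    using that cycle_imp_subset_arcs by (auto simp: cycle_sets_def)
  then show ?thesis
    using cycle_sets_subdigraph[OF assms wf_digraph_del_arc, of e] by auto
qed

section \<open>The cycle polynomial as a sum over arc sets\<close>

lemma (in fin_digraph) finite_cycle_sets: "finite (cycle_sets G)"
  by (rule finite_subset[of _ "Pow (arcs G)"])
    (auto simp: cycle_sets_def dest: cycle_imp_subset_arcs)

text \<open>Grouping the cycles by cardinality gives the coefficients. No cycle falls outside the
  range of summation: it has at least one arc, and the heads of its arcs are distinct
  vertices.\<close>

lemma (in fin_digraph) cycle_poly_conv:
  "cycle_poly G = (\<Sum>S\<in>cycle_sets G. monom 1 (card S))"
proof -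
  have card: "card S \<in> {1..card (verts G)}" if in_cycles: "S \<in> cycle_sets G" for S
  proof -
    obtain p where S: "S = set p" and "cycle p"
      using in_cycles by (auto simp: cycle_sets_def)
    then obtain u where u: "awalk u p u" "distinct (tl (awalk_verts u p))"
        and p: "distinct p" "p \<noteq> []"
      unfolding cycle_conv by metis
    have "set (tl (awalk_verts u p)) \<subseteq> verts G"
      using u(1) by (meson awalkE' list.set_sel(2) awalk_verts_non_Nil subset_iff)
    then have "card (set (tl (awalk_verts u p))) \<le> card (verts G)"
      by (intro card_mono) auto
    then have "length p \<le> card (verts G)"
      using distinct_card[OF u(2)] by (simp add: length_awalk_verts)
    then show ?thesis
      using S p by (simp add: distinct_card Suc_le_eq)
  qed
  have "cycles_of_length G k = {S \<in> cycle_sets G. card S = k}" for k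
    unfolding cycles_of_length_def cycle_sets_def
    using cycle_imp_distinct distinct_card by fastforce
  then have "cycle_poly G =
      (\<Sum>k = 1..card (verts G). \<Sum>S \<in> {S \<in> cycle_sets G. card S = k}. monom 1 (card S))"
    by (simp add: cycle_poly_def of_nat_monom mult_monom)
  also have "\<dots> = (\<Sum>S\<in>cycle_sets G. monom 1 (card S))"
    using card by (intro sum.group finite_cycle_sets) auto
  finally show ?thesis .
qed

lemma cycle_poly_del_arc:
  assumes "fin_digraph D"
  shows "cycle_poly D = cycle_poly (pre_digraph.del_arc D e)
    + (\<Sum>S\<in>{S \<in> cycle_sets D. e \<in> S}. monom 1 (card S))"
proof -
  interpret fin_digraph D by fact
  interpret del: fin_digraph "del_arc e" by (rule fin_digraph_del_arc)
  have "cycle_sets D = {S \<in> cycle_sets D. e \<notin> S} \<union> {S \<in> cycle_sets D. e \<in> S}"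
    by auto
  then have "(\<Sum>S\<in>cycle_sets D. monom 1 (card S)) = (\<Sum>S\<in>{S \<in> cycle_sets D. e \<notin> S}. monom 1 (card S))
    + (\<Sum>S\<in>{S \<in> cycle_sets D. e \<in> S}. monom (1::int) (card S))"
    using finite_cycle_sets by (subst sum.union_disjoint[symmetric]) auto
  then show ?thesis
    by (simp add: cycle_poly_conv del.cycle_poly_conv cycle_sets_del_arc[OF wf_digraph_axioms])
qed

text \<open>After the loop, the rest of the cycle is a simple path from a vertex to itself, hence
  empty.\<close>

lemma (in wf_digraph) cycle_sets_through_loop:
  assumes "e \<in> arcs G" and "tail G e = head G e"
  shows "{S \<in> cycle_sets G. e \<in> S} = {{e}}"
proof -
  have "apath (tail G e) q (tail G e) \<longleftrightarrow> q = []" for q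
    using assms(1) apath_nonempty_ends by (auto simp: apath_Nil_iff)
  then show ?thesis
    using cycle_sets_through_iff[OF assms(1)] assms(2) by auto
qed

section \<open>Paths and cycles in the contraction of a non-loop arc\<close>

locale non_loop = fin_digraph D for D :: "('a, 'b) pre_digraph" +
  fixes e u v
  assumes e: "e \<in> arcs D" and u: "tail D e = u" and v: "head D e = v" and uv: "u \<noteq> v"
begin

text \<open>A global copy of the map that is local to \<open>contract_arc\<close>.\<close>

definition merge :: "'a \<Rightarrow> 'a" where "merge w = (if w = v then u else w)"

abbreviation "C \<equiv> contract_arc D e"

lemma contract_simps:
  "verts C = merge ` verts D"
  "arcs C = {a \<in> arcs D. tail D a \<noteq> u \<and> head D a \<noteq> v}"
  "tail C a = merge (tail D a)"
  "head C a = merge (head D a)"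
  using uv by (auto simp: contract_arc_def Let_def u v merge_def[abs_def])

sublocale C: fin_digraph C
  by (rule fin_digraph_contract_arc[OF fin_digraph_axioms e])

lemma awalk_verts_contract: "C.awalk_verts (merge w) q = map merge (awalk_verts w q)"
  by (induction q arbitrary: w) (auto simp: contract_simps)

text \<open>No arc of \<open>C\<close> has head \<open>v\<close> in \<open>D\<close>, so a walk in
  \<open>D\<close> along such arcs that starts elsewhere never meets \<open>v\<close>, and merging
  leaves its vertices unchanged.\<close>

lemma apath_contract_iff:
  assumes "w \<in> verts D" and "w \<noteq> v" and "set q \<subseteq> arcs C"
  shows "C.apath (merge w) q u \<longleftrightarrow> apath w q u"
  using assms
proof (induction q arbitrary: w)
  case Nil
  then show ?case
    by (auto simp: C.apath_Nil_iff apath_Nil_iff contract_simps merge_def)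
next
  case (Cons b q)
  have b: "b \<in> arcs D" "tail D b \<noteq> u" "head D b \<noteq> v" "b \<in> arcs C"
    using Cons.prems by (auto simp: contract_simps)
  show ?case
  \<comment> \<open>At \<open>w = u\<close> both sides fail, because a nonempty simple path to
    \<open>u\<close> cannot start at \<open>u\<close>. Any other \<open>w\<close> differs from
    \<open>u\<close> and \<open>v\<close>, so its only preimage under \<open>merge\<close> is
    \<open>w\<close> itself.\<close>
  proof (cases "w = u")
    case True
    then show ?thesis
      using uv C.apath_nonempty_ends[of u "b # q" u] apath_nonempty_ends[of u "b # q" u]
      by (auto simp: merge_def)
  next
    case False
    have merge_eq: "merge x = w \<longleftrightarrow> x = w" for x
      using False Cons.prems(2) by (auto simp: merge_def)
    then have w: "merge w = w" and in_image: "w \<in> merge ` A \<longleftrightarrow> w \<in> A" for A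
      by (metis image_iff)+
    have IH: "C.apath (merge (head D b)) q u \<longleftrightarrow> apath (head D b) q u"
      using Cons b by auto
    have "C.apath w (b # q) u \<longleftrightarrow> tail D b = w \<and> apath (head D b) q u \<and>
        w \<notin> set (awalk_verts (head D b) q)"
      unfolding C.apath_Cons_iff contract_simps(3,4) awalk_verts_contract set_map IH merge_eq
      using in_image b(4) merge_eq by metis
    then show ?thesis
      unfolding w apath_Cons_iff using b(1) by metis
  qed
qed

text \<open>On a simple path from \<open>v\<close> to \<open>u\<close>, the last vertex
  \<open>u\<close> is not the tail of any arc and the first vertex \<open>v\<close> is not the head
  of any arc. These are the two conditions for an arc to survive contraction.\<close>

lemma apath_imp_subset_arcs_contract:
  assumes "apath v q u"
  shows "set q \<subseteq> arcs C"
proof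
  fix a assume a: "a \<in> set q"
  have q: "q \<noteq> []" "cas v q u" "distinct (awalk_verts v q)" "set q \<subseteq> arcs D"
    using assms a by (auto simp: apath_def)
  have "distinct (map (tail D) q @ [head D (last q)])" "last (map (tail D) q @ [head D (last q)]) = u"
    using q awlast_if_cas[OF q(2)] by (auto simp: awalk_verts_conv)
  moreover have "distinct (v # map (head D) q)"
    using q awhd_if_cas[OF q(2)] by (auto simp: awalk_verts_conv' split: if_splits)
  ultimately show "a \<in> arcs C"
    using a q(4) by (auto simp: contract_simps image_iff)
qed

text \<open>Arcs with tail \<open>u\<close> are removed, so an arc of \<open>C\<close> leaving the
  merged vertex has tail \<open>v\<close> in \<open>D\<close>. Undoing the identification therefore
  opens the cycle into a path from \<open>v\<close> to \<open>u\<close>.\<close>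

lemma cycle_contract_iff:
  assumes "tail C a = u"
  shows "C.cycle (a # q) \<longleftrightarrow> apath v (a # q) u"
proof (cases "set (a # q) \<subseteq> arcs C")
  case True
  then have a: "a \<in> arcs C" "a \<in> arcs D" "tail D a = v" "head D a \<noteq> v"
    using assms by (auto simp: contract_simps merge_def split: if_splits)
  have "v \<notin> set (awalk_verts (head D a) q)" if "apath (head D a) q u"
  proof -
    have "cas (head D a) q u" using that by (auto simp: apath_def)
    then show ?thesis
      using True a by (subst awalk_verts_conv') (auto simp: contract_simps cas_simp)
  qed
  then show ?thesis
    using True a apath_contract_iff[of "head D a" q] assms
    by (auto simp: C.cycle_Cons_iff apath_Cons_iff contract_simps(4))
next
  case False
  then show ?thesis
    using apath_imp_subset_arcs_contract C.cycle_imp_subset_arcs by blast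
qed

text \<open>The cycle is rotated to start with an arc leaving the merged vertex. Conversely, a path
  from \<open>v\<close> to \<open>u\<close> has a first arc because \<open>u\<close> and
  \<open>v\<close> differ.\<close>

lemma cycle_sets_contract_iff:
  "T \<in> cycle_sets C \<and> u \<in> tail C ` T \<longleftrightarrow> (\<exists>q. T = set q \<and> apath v q u)"
proof
  assume "T \<in> cycle_sets C \<and> u \<in> tail C ` T"
  then obtain p a where "C.cycle p" "T = set p" "a \<in> set p" "tail C a = u"
    by (auto simp: cycle_sets_def)
  then show "\<exists>q. T = set q \<and> apath v q u"
    by (metis C.cycle_rotate cycle_contract_iff list.simps(15))
next
  assume "\<exists>q. T = set q \<and> apath v q u"
  then obtain q where q: "T = set q" "apath v q u" by blast
  then obtain a r where r: "q = a # r"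
    using uv by (cases q) (auto simp: apath_Nil_iff)
  then have "tail C a = u"
    using q(2) by (auto simp: apath_Cons_iff contract_simps merge_def)
  then show "T \<in> cycle_sets C \<and> u \<in> tail C ` T"
    using q cycle_contract_iff[of a r] unfolding r cycle_sets_def
      by (metis image_eqI list.set_intros(1) mem_Collect_eq)
qed

section \<open>Comparison of the cycle sets and summation\<close>

lemma cycle_sets_through_eq:
  "{S \<in> cycle_sets D. e \<in> S} = insert e ` {T \<in> cycle_sets C. u \<in> tail C ` T}"
proof -
  have "S \<in> cycle_sets D \<and> e \<in> S \<longleftrightarrow>
      (\<exists>T. S = insert e T \<and> T \<in> cycle_sets C \<and> u \<in> tail C ` T)" for S
    unfolding cycle_sets_through_iff[OF e] cycle_sets_contract_iff u v by metis
  then show ?thesis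
    unfolding image_def by auto
qed

lemma subset_arcs_contract: "T \<in> cycle_sets C \<Longrightarrow> T \<subseteq> arcs C"
  using C.cycle_imp_subset_arcs by (auto simp: cycle_sets_def)

lemma e_notin_cycle_sets_contract: "T \<in> cycle_sets C \<Longrightarrow> e \<notin> T"
  using subset_arcs_contract u by (auto simp: contract_simps)

text \<open>The comparison is with \<open>C\<close>: \<open>merge\<close> fixes the ends of every
  arc that touches neither \<open>u\<close> nor \<open>v\<close>, so deleting both vertices leaves a
  digraph whose arcs and their ends are inherited from \<open>C\<close>.\<close>

lemma cycle_sets_del_arc_ends:
  "cycle_sets (del_arc_ends D e) = {T \<in> cycle_sets C. u \<notin> tail C ` T}"
proof -
  interpret del: fin_digraph "del_arc_ends D e"
    by (rule fin_digraph_del_arc_ends[OF fin_digraph_axioms])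
  have arcs: "arcs (del_arc_ends D e) = {a \<in> arcs D. tail D a \<notin> {u, v} \<and> head D a \<notin> {u, v}}"
    by (auto simp: del_arc_ends_def u v pre_digraph.del_vert_def)
  have "cycle_sets (del_arc_ends D e) = {T \<in> cycle_sets C. T \<subseteq> arcs (del_arc_ends D e)}"
    by (rule cycle_sets_subdigraph[OF C.wf_digraph_axioms del.wf_digraph_axioms])
      (auto simp: arcs contract_simps merge_def del_arc_ends_def pre_digraph.del_vert_def u v)
  moreover have "T \<subseteq> arcs (del_arc_ends D e) \<longleftrightarrow> u \<notin> tail C ` T" if T: "T \<in> cycle_sets C" for T
  proof
    assume "T \<subseteq> arcs (del_arc_ends D e)"
    then show "u \<notin> tail C ` T"
      by (auto simp: arcs contract_simps merge_def)
  next
    assume no_tail: "u \<notin> tail C ` T"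
    \<comment> \<open>In a cycle, an arc entering the merged vertex is followed by an arc leaving
      it. For a loop this is the same arc.\<close>
    have "u \<notin> head C ` T"
    proof
      assume "u \<in> head C ` T"
      then obtain p a where "C.cycle p" "T = set p" "a \<in> set p" "head C a = u"
        using T by (auto simp: cycle_sets_def)
      then obtain q where "C.apath u q (tail C a)" "T = set (a # q)"
        by (metis C.cycle_rotate C.cycle_Cons_iff list.simps(15))
      then show False
        using no_tail by (cases q) (auto simp: C.apath_Nil_iff C.apath_Cons_iff)
    qed
    then show "T \<subseteq> arcs (del_arc_ends D e)"
      using no_tail subset_arcs_contract[OF T]
      by (fastforce simp: arcs contract_simps merge_def)
  qed
  ultimately show ?thesis by auto
qed

text \<open>Adding \<open>e\<close> to a cycle of \<open>C\<close> raises its cardinality by one,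
  whence the factor \<open>[:0, 1:]\<close>, which is the indeterminate. The cycles of
  \<open>C\<close> through the merged vertex are counted as all cycles of \<open>C\<close> minus
  those avoiding it.\<close>

lemma sum_cycle_sets_through:
  "(\<Sum>S\<in>{S \<in> cycle_sets D. e \<in> S}. monom 1 (card S)) =
    [:0, 1:] * cycle_poly C - [:0, 1:] * cycle_poly (del_arc_ends D e)"
proof -
  interpret del: fin_digraph "del_arc_ends D e"
    by (rule fin_digraph_del_arc_ends[OF fin_digraph_axioms])
  define P where "P = {T \<in> cycle_sets C. u \<in> tail C ` T}"
  define Q where "Q = {T \<in> cycle_sets C. u \<notin> tail C ` T}"
  have "inj_on (insert e) P"
    by (rule inj_onI) (metis (no_types, lifting) P_def e_notin_cycle_sets_contract insert_ident mem_Collect_eq)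
  then have "(\<Sum>S\<in>insert e ` P. monom (1::int) (card S)) = (\<Sum>T\<in>P. monom 1 (card (insert e T)))"
    by (simp add: sum.reindex)
  also have "\<dots> = (\<Sum>T\<in>P. [:0, 1:] * monom 1 (card T))"
  proof (rule sum.cong)
    fix T assume "T \<in> P"
    then have "T \<in> cycle_sets C" by (simp add: P_def)
    then have "e \<notin> T" "finite T"
      using e_notin_cycle_sets_contract by (auto simp: cycle_sets_def)
    then show "monom 1 (card (insert e T)) = [:0, 1:] * monom (1::int) (card T)"
      by (simp add: monom_Suc)
  qed simp
  finally have through: "(\<Sum>S\<in>insert e ` P. monom (1::int) (card S)) = [:0, 1:] * (\<Sum>T\<in>P. monom 1 (card T))"
    by (simp add: sum_distrib_left)
  have "cycle_sets C = P \<union> Q" "P \<inter> Q = {}" "finite P" "finite Q"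
    using C.finite_cycle_sets by (auto simp: P_def Q_def)
  then have "cycle_poly C = (\<Sum>T\<in>P. monom 1 (card T)) + cycle_poly (del_arc_ends D e)"
    unfolding C.cycle_poly_conv del.cycle_poly_conv cycle_sets_del_arc_ends Q_def[symmetric]
    by (simp add: sum.union_disjoint)
  then show ?thesis
    unfolding cycle_sets_through_eq P_def[symmetric] through by (simp add: algebra_simps)
qed

end

theorem theorem2p1:
  fixes D :: "('a, 'b) pre_digraph" and e :: 'b
  assumes "fin_digraph D" and "e \<in> arcs D"
  shows "(tail D e = head D e \<longrightarrow>
            cycle_poly D = cycle_poly (pre_digraph.del_arc D e) + [:0, 1:]) \<and>
         (tail D e \<noteq> head D e \<and>
          \<not> (\<exists>a \<in> arcs D. tail D a = head D a \<and> tail D a \<in> {tail D e, head D e}) \<longrightarrow>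
            cycle_poly D = cycle_poly (pre_digraph.del_arc D e)
              + [:0, 1:] * cycle_poly (contract_arc D e)
              - [:0, 1:] * cycle_poly (del_arc_ends D e))"
proof (intro conjI impI)
  interpret fin_digraph D by fact
  assume "tail D e = head D e"
  \<comment> \<open>The only summand comes from \<open>{e}\<close>, which has cardinality 1.\<close>
  then have "(\<Sum>S\<in>{S \<in> cycle_sets D. e \<in> S}. monom (1::int) (card S)) = [:0, 1:]"
    using cycle_sets_through_loop[OF assms(2)] by (simp add: monom_Suc)
  then show "cycle_poly D = cycle_poly (pre_digraph.del_arc D e) + [:0, 1:]"
    using cycle_poly_del_arc[OF assms(1), of e] by simp
next
  assume "tail D e \<noteq> head D e \<and>
    \<not> (\<exists>a \<in> arcs D. tail D a = head D a \<and> tail D a \<in> {tail D e, head D e})"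
  then interpret non_loop D e "tail D e" "head D e"
    using assms by (auto simp: non_loop_def non_loop_axioms_def)
  show "cycle_poly D = cycle_poly (pre_digraph.del_arc D e)
      + [:0, 1:] * cycle_poly (contract_arc D e)
      - [:0, 1:] * cycle_poly (del_arc_ends D e)"
    using cycle_poly_del_arc[OF assms(1), of e] sum_cycle_sets_through by simp
qed

end
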